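(* As formal power series in $q$, $$\sum_{n\geq 0} M_n(u_1,u_2,u_3;v_1,v_2)q^{n}=\frac{1-v_1q+(u_3-u_1)q^2-\sqrt{1-2v_1q+(v_1^2-2(u_1+u_3))q^2+2(u_1v_1+u_3v_1-2u_2v_2)q^3+(u_3-u_1)^2q^4}}{2q^2},$$ where the square root is the power series with constant term $1$.
   Context: A plane tree is an unlabeled rooted tree in which the children of every vertex are linearly ordered from left to right. A leaf is a vertex with no children, an interior vertex one with at least one child. A tip-augmented plane tree is a plane tree in which the leftmost child of every interior vertex is a leaf; $\mathcal T_m$ denotes the set of tip-augmented plane trees with $m$ edges. In such a tree: a leaf without siblings is a singleton leaf; a leaf with siblings that is the leftmost child of its parent is an elder twin leaf if the second child of its parent is also a leaf, and an elder non-twin leaf otherwise; a leaf with siblings that is the second child of its parent is a second leaf; a leaf with siblings that is neither the first nor the second child of its parent is a younger leaf. Let $\mathrm{sleaf},\mathrm{etleaf},\mathrm{entleaf},\mathrm{syleaf},\mathrm{yerleaf}$ count these five kinds respectively. For $n\ge1$, $M_n(u_1,u_2,u_3;v_1,v_2)=\sum_{T\in\mathcal T_{n+1}}u_1^{\mathrm{sleaf}(T)}u_2^{\mathrm{etleaf}(T)}u_3^{\mathrm{entleaf}(T)}v_1^{\mathrm{yerleaf}(T)}v_2^{\mathrm{syleaf}(T)}$, and $M_0(u_1,u_2,u_3;v_1,v_2)=u_3$ by convention. *)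

theory Defs
  imports "HOL-Computational_Algebra.Computational_Algebra"
begin

section \<open>Plane trees\<close>

text \<open>A plane tree is given by the list of the subtrees at the children of its root, from left
  to right.\<close>

datatype ptree = Node (children: "ptree list")

fun edges :: "ptree \<Rightarrow> nat" where
  "edges (Node ts) = (\<Sum>t\<leftarrow>ts. Suc (edges t))"

definition is_leaf :: "ptree \<Rightarrow> bool" where
  "is_leaf t \<longleftrightarrow> children t = []"

fun tip_augmented :: "ptree \<Rightarrow> bool" where
  "tip_augmented (Node ts) \<longleftrightarrow>
     (ts \<noteq> [] \<longrightarrow> is_leaf (ts ! 0)) \<and> (\<forall>t\<in>set ts. tip_augmented t)"

definition tip_trees :: "nat \<Rightarrow> ptree set" where
  "tip_trees m = {T. tip_augmented T \<and> edges T = m}"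

lemma finite_edges_le: "finite {T. edges T \<le> m}"
proof (induction m)
  case 0
  have "T = Node []" if "edges T \<le> 0" for T
    using that by (cases T rule: edges.cases) (auto simp: sum_list_eq_0_iff)
  then have "{T. edges T \<le> 0} \<subseteq> {Node []}" by blast
  then show ?case by (rule finite_subset) simp
next
  case (Suc m)
  let ?L = "{ts. set ts \<subseteq> {T. edges T \<le> m} \<and> length ts \<le> Suc m}"
  have "T \<in> Node ` ?L" if "edges T \<le> Suc m" for T
  proof (cases T)
    case (Node ts)
    have le: "(\<Sum>t\<leftarrow>ts. Suc (edges t)) \<le> Suc m" using that Node by simp
    have "edges t \<le> m" if "t \<in> set ts" for t
      using le member_le_sum_list[of "Suc (edges t)" "map (\<lambda>t. Suc (edges t)) ts"] that by auto
    moreover have "length ts \<le> (\<Sum>t\<leftarrow>ts. Suc (edges t))"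
      by (induction ts) auto
    ultimately show ?thesis using le Node by auto
  qed
  then have "{T. edges T \<le> Suc m} \<subseteq> Node ` ?L" by blast
  then show ?case
    by (rule finite_subset) (intro finite_imageI finite_lists_length_le Suc.IH)
qed

lemma finite_tip_trees: "finite (tip_trees m)"
  by (rule finite_subset[OF _ finite_edges_le[of m]]) (auto simp: tip_trees_def)

section \<open>Leaf statistics\<close>

text \<open>The number of non-root leaves whose position is described by \<open>P\<close>, where \<open>P ts i\<close> refers to
  the child number \<open>i\<close> (counted from 0) of a vertex with list of children \<open>ts\<close>. The root of the
  one-vertex tree is never counted; this tree has no edges and plays no role below.\<close>

fun count_leaves :: "(ptree list \<Rightarrow> nat \<Rightarrow> bool) \<Rightarrow> ptree \<Rightarrow> nat" where
  "count_leaves P (Node ts) =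
     card {i. i < length ts \<and> is_leaf (ts ! i) \<and> P ts i} + (\<Sum>t\<leftarrow>ts. count_leaves P t)"

definition sleaf :: "ptree \<Rightarrow> nat" where
  "sleaf = count_leaves (\<lambda>ts i. length ts = 1)"

definition etleaf :: "ptree \<Rightarrow> nat" where
  "etleaf = count_leaves (\<lambda>ts i. length ts \<ge> 2 \<and> i = 0 \<and> is_leaf (ts ! 1))"

definition entleaf :: "ptree \<Rightarrow> nat" where
  "entleaf = count_leaves (\<lambda>ts i. length ts \<ge> 2 \<and> i = 0 \<and> \<not> is_leaf (ts ! 1))"

definition syleaf :: "ptree \<Rightarrow> nat" where
  "syleaf = count_leaves (\<lambda>ts i. length ts \<ge> 2 \<and> i = 1)"

definition yerleaf :: "ptree \<Rightarrow> nat" where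
  "yerleaf = count_leaves (\<lambda>ts i. length ts \<ge> 2 \<and> i \<noteq> 0 \<and> i \<noteq> 1)"

definition M :: "nat \<Rightarrow> 'a::comm_semiring_1 \<Rightarrow> 'a \<Rightarrow> 'a \<Rightarrow> 'a \<Rightarrow> 'a \<Rightarrow> 'a" where
  "M n u1 u2 u3 v1 v2 =
     (if n = 0 then u3
      else \<Sum>T\<in>tip_trees (n + 1).
        u1 ^ sleaf T * u2 ^ etleaf T * u3 ^ entleaf T * v1 ^ yerleaf T * v2 ^ syleaf T)"

section \<open>Square roots of power series\<close>

text \<open>The argument \<open>\<lambda>_ _. 1\<close> of \<^const>\<open>fps_radical\<close> prescribes the constant term 1 of the root.
  It is meant for series with constant term 1.\<close>

definition fps_sqrt1 :: "'a::field_char_0 fps \<Rightarrow> 'a fps" where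
  "fps_sqrt1 a = fps_radical (\<lambda>_ _. 1) 2 a"

lemma fps_sqrt1_unique:
  fixes a s :: "'a::field_char_0 fps"
  assumes "fps_nth a 0 = 1"
  shows "s = fps_sqrt1 a \<longleftrightarrow> s ^ 2 = a \<and> fps_nth s 0 = 1"
proof
  assume "s = fps_sqrt1 a"
  then show "s ^ 2 = a \<and> fps_nth s 0 = 1"
    using power_radical[of a "\<lambda>_ _. 1" 1] assms by (simp add: fps_sqrt1_def numeral_2_eq_2)
next
  assume "s ^ 2 = a \<and> fps_nth s 0 = 1"
  then show "s = fps_sqrt1 a"
    using radical_unique[of "\<lambda>_ _. 1" 1 a s] assms by (simp add: fps_sqrt1_def numeral_2_eq_2)
qed

end

theory Submission
  imports Defs
begin

text \<open>Let \<open>B\<close> be the generating function of the tip-augmented trees with at least one edge. Below a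
  root with at least two children, the children from the third one on form an arbitrary sequence
  whose terms are leaves of weight \<open>v1\<close> or trees counted by \<open>B\<close>. Distinguishing whether the
  second child is a leaf gives
  \<open>B = u1 q + (u2 v2 q^2 + u3 q^2 B) / (1 - q (v1 + B))\<close>. Since \<open>B = q (M - (u3 - u1))\<close>, this is a
  quadratic equation for \<open>M\<close>, whose discriminant is the series under the root.\<close>

section \<open>Generating functions of graded sets\<close>

text \<open>A sum over an infinite set is 0 by default, so a coefficient is meaningful only when its
  level is finite; hence the finiteness hypotheses for unions and products below.\<close>

definition gf :: "'b set \<Rightarrow> ('b \<Rightarrow> nat) \<Rightarrow> ('b \<Rightarrow> 'a::comm_ring_1) \<Rightarrow> 'a fps" where
  "gf A sz w = Abs_fps (\<lambda>n. \<Sum>x\<in>{x\<in>A. sz x = n}. w x)"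

lemma gf_cong:
  assumes "\<And>x. x \<in> A \<Longrightarrow> sz x = sz' x" "\<And>x. x \<in> A \<Longrightarrow> w x = w' x"
  shows "gf A sz w = gf A sz' w'"
  unfolding gf_def using assms by (auto intro!: arg_cong[where f = Abs_fps] ext sum.cong)

lemma gf_singleton: "gf {x} sz w = fps_const (w x) * fps_X ^ sz x"
proof -
  have "{y \<in> {x}. sz y = n} = (if n = sz x then {x} else {})" for n
    by auto
  then show ?thesis
    by (auto simp: gf_def fps_eq_iff fps_X_power_nth)
qed

lemma gf_Un:
  assumes "A \<inter> B = {}" "\<And>n. finite {x\<in>A. sz x = n}" "\<And>n. finite {x\<in>B. sz x = n}"
  shows "gf (A \<union> B) sz w = gf A sz w + gf B sz w"
proof -
  have "{x \<in> A \<union> B. sz x = n} = {x\<in>A. sz x = n} \<union> {x\<in>B. sz x = n}" for n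
    by auto
  then show ?thesis
    using assms by (auto simp: gf_def fps_eq_iff intro!: sum.union_disjoint)
qed

lemma gf_image:
  assumes "inj_on f A"
  shows "gf (f ` A) sz w = gf A (\<lambda>x. sz (f x)) (\<lambda>x. w (f x))"
proof -
  have "{y \<in> f ` A. sz y = n} = f ` {x\<in>A. sz (f x) = n}" for n
    by auto
  moreover have "inj_on f {x\<in>A. sz (f x) = n}" for n
    using assms by (rule inj_on_subset) auto
  ultimately show ?thesis
    by (simp add: gf_def sum.reindex)
qed

lemma gf_shift: "gf A (\<lambda>x. k + sz x) (\<lambda>x. c * w x) = fps_const c * fps_X ^ k * gf A sz w"
proof (rule fps_ext)
  fix n
  \<comment> \<open>Subtraction on \<open>nat\<close> truncates, so the levels below
    \<open>k\<close> are split off.\<close>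
  have "{x\<in>A. k + sz x = n} = (if n < k then {} else {x\<in>A. sz x = n - k})"
    by auto
  then show "fps_nth (gf A (\<lambda>x. k + sz x) (\<lambda>x. c * w x)) n =
      fps_nth (fps_const c * fps_X ^ k * gf A sz w) n"
    by (auto simp: gf_def mult.assoc fps_X_power_mult_nth sum_distrib_left)
qed

text \<open>Level \<open>n\<close> of the product is the disjoint union of the rectangles
  \<open>?F i\<close>, which gives the Cauchy product.\<close>

lemma gf_times:
  assumes "\<And>n. finite {x\<in>A. sz x = n}" "\<And>n. finite {y\<in>B. sz' y = n}"
  shows "gf (A \<times> B) (\<lambda>(x, y). sz x + sz' y) (\<lambda>(x, y). w x * w' y) = gf A sz w * gf B sz' w'"
proof (rule fps_ext)
  fix n
  let ?F = "\<lambda>i. {x\<in>A. sz x = i} \<times> {y\<in>B. sz' y = n - i}"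
  have "{p \<in> A \<times> B. (\<lambda>(x, y). sz x + sz' y) p = n} = (\<Union>i\<in>{0..n}. ?F i)"
    by auto
  moreover have "(\<Sum>p\<in>(\<Union>i\<in>{0..n}. ?F i). (\<lambda>(x, y). w x * w' y) p) =
      (\<Sum>i=0..n. \<Sum>p\<in>?F i. (\<lambda>(x, y). w x * w' y) p)"
    using assms by (intro sum.UNION_disjoint) auto
  moreover have "(\<Sum>p\<in>?F i. (\<lambda>(x, y). w x * w' y) p) =
      (\<Sum>x\<in>{x\<in>A. sz x = i}. w x) * (\<Sum>y\<in>{y\<in>B. sz' y = n - i}. w' y)" for i
    by (simp add: sum_product sum.cartesian_product)
  ultimately show "fps_nth (gf (A \<times> B) (\<lambda>(x, y). sz x + sz' y) (\<lambda>(x, y). w x * w' y)) n =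
      fps_nth (gf A sz w * gf B sz' w') n"
    by (simp add: gf_def fps_mult_nth)
qed

section \<open>Leaf statistics of a tree with given root degree\<close>

abbreviation leaf :: ptree where
  "leaf \<equiv> Node []"

lemma is_leaf_iff: "is_leaf t \<longleftrightarrow> t = leaf"
  by (cases t) (simp add: is_leaf_def)

lemmas stat_defs = sleaf_def etleaf_def entleaf_def syleaf_def yerleaf_def

lemma stats_leaf [simp]:
  "sleaf leaf = 0" "etleaf leaf = 0" "entleaf leaf = 0" "syleaf leaf = 0" "yerleaf leaf = 0"
  by (simp_all add: stat_defs)

lemma stats_single:
  "sleaf (Node [leaf]) = 1" "etleaf (Node [leaf]) = 0" "entleaf (Node [leaf]) = 0"
  "syleaf (Node [leaf]) = 0" "yerleaf (Node [leaf]) = 0"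
proof -
  have "{i. i < Suc 0 \<and> is_leaf ([leaf] ! i)} = {0}"
    by (auto simp: is_leaf_def)
  then show "sleaf (Node [leaf]) = 1" by (simp add: stat_defs)
qed (simp_all add: stat_defs)

lemma sleaf_Cons2:
  "sleaf (Node (leaf # t # ts)) = sleaf t + (\<Sum>t\<leftarrow>ts. sleaf t)"
  by (simp add: stat_defs)

text \<open>A leaf is counted at its parent, so the leaf status of \<open>t\<close> enters through
  the root's \<open>card\<close> term and not through \<open>etleaf t\<close>.\<close>

lemma etleaf_Cons2:
  "etleaf (Node (leaf # t # ts)) = of_bool (is_leaf t) + etleaf t + (\<Sum>t\<leftarrow>ts. etleaf t)"
proof -
  have "{i. i < length (leaf # t # ts) \<and> is_leaf ((leaf # t # ts) ! i) \<and>
      length (leaf # t # ts) \<ge> 2 \<and> i = 0 \<and> is_leaf ((leaf # t # ts) ! 1)} =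
      (if is_leaf t then {0} else {})"
    by (auto simp: is_leaf_def)
  then show ?thesis by (simp add: stat_defs)
qed

lemma entleaf_Cons2:
  "entleaf (Node (leaf # t # ts)) = of_bool (\<not> is_leaf t) + entleaf t + (\<Sum>t\<leftarrow>ts. entleaf t)"
proof -
  have "{i. i < length (leaf # t # ts) \<and> is_leaf ((leaf # t # ts) ! i) \<and>
      length (leaf # t # ts) \<ge> 2 \<and> i = 0 \<and> \<not> is_leaf ((leaf # t # ts) ! 1)} =
      (if is_leaf t then {} else {0})"
    by (auto simp: is_leaf_def)
  then show ?thesis by (simp add: stat_defs)
qed

lemma syleaf_Cons2:
  "syleaf (Node (leaf # t # ts)) = of_bool (is_leaf t) + syleaf t + (\<Sum>t\<leftarrow>ts. syleaf t)"
proof -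
  have "{i. i < length (leaf # t # ts) \<and> is_leaf ((leaf # t # ts) ! i) \<and>
      length (leaf # t # ts) \<ge> 2 \<and> i = 1} = (if is_leaf t then {1} else {})"
    by auto
  then show ?thesis by (simp add: stat_defs)
qed

lemma yerleaf_Cons2:
  "yerleaf (Node (leaf # t # ts)) =
    length (filter is_leaf ts) + yerleaf t + (\<Sum>t\<leftarrow>ts. yerleaf t)"
proof -
  have "{i. i < length (leaf # t # ts) \<and> is_leaf ((leaf # t # ts) ! i) \<and>
      length (leaf # t # ts) \<ge> 2 \<and> i \<noteq> 0 \<and> i \<noteq> 1} =
      (\<lambda>i. Suc (Suc i)) ` {i. i < length ts \<and> is_leaf (ts ! i)}" (is "?L = ?R")
  proof (intro equalityI subsetI)
    fix i assume i: "i \<in> ?L"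
    then have "2 \<le> i" by simp
    then obtain j where "i = Suc (Suc j)"
      using le_Suc_ex[of 2 i] by auto
    then show "i \<in> ?R" using i by simp
  qed auto
  then show ?thesis
    by (simp add: stat_defs card_image inj_on_def length_filter_conv_card)
qed

section \<open>The functional equation\<close>

text \<open>The one-vertex tree is left out because its contribution as a child depends on its
  position.\<close>

definition planted :: "ptree set" where
  "planted = {T. tip_augmented T \<and> T \<noteq> leaf}"

definition forests :: "ptree list set" where
  "forests = {ts. \<forall>t\<in>set ts. tip_augmented t}"

definition fsize :: "ptree list \<Rightarrow> nat" where
  "fsize ts = (\<Sum>t\<leftarrow>ts. Suc (edges t))"

lemma fsize_simps [simp]: "fsize [] = 0" "fsize (t # ts) = Suc (edges t) + fsize ts"
  by (simp_all add: fsize_def)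

lemma edges_Node: "edges (Node ts) = fsize ts"
  by (simp add: fsize_def)

lemma finite_planted: "finite {T\<in>planted. edges T = n}"
  by (rule finite_subset[OF _ finite_tip_trees[of n]]) (auto simp: tip_trees_def planted_def)

text \<open>\<open>Node\<close> is injective and turns \<open>fsize\<close> into
  \<open>edges\<close>, so finiteness is inherited from trees.\<close>

lemma finite_forests: "finite {ts\<in>forests. fsize ts = n}"
proof (rule finite_imageD)
  show "finite (Node ` {ts\<in>forests. fsize ts = n})"
    by (rule finite_subset[OF _ finite_edges_le[of n]])
      (auto simp: edges_Node simp del: edges.simps)
qed (simp add: inj_on_def)

lemma forests_decomp:
  "forests = {[]} \<union> ((#) leaf ` forests \<union> (\<lambda>(t, ts). t # ts) ` (planted \<times> forests))"
  (is "_ = ?R")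
proof (intro equalityI subsetI)
  fix ts assume "ts \<in> forests"
  then show "ts \<in> ?R"
    by (cases ts) (auto simp: forests_def planted_def image_iff)
qed (auto simp: forests_def planted_def)

text \<open>Tip augmentation makes the first child a leaf. The three pieces are: no second child, a
  leaf as second child, a larger subtree there.\<close>

lemma planted_decomp:
  "planted = {Node [leaf]} \<union> ((\<lambda>ts. Node (leaf # leaf # ts)) ` forests \<union>
     (\<lambda>(t, ts). Node (leaf # t # ts)) ` (planted \<times> forests))"
  (is "_ = ?R")
proof (intro equalityI subsetI)
  fix T assume T: "T \<in> planted"
  obtain ts where ts: "T = Node ts" by (cases T)
  show "T \<in> ?R"
  proof (cases "tl ts")
    case Nil
    then show ?thesis using T ts
      by (cases ts) (auto simp: planted_def is_leaf_iff)
  next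
    case (Cons t rs)
    then have "T = Node (leaf # t # rs)" "tip_augmented t" "rs \<in> forests"
      using T ts by (cases ts; auto simp: planted_def is_leaf_iff forests_def)+
    then show ?thesis
      by (cases "t = leaf") (auto simp: planted_def)
  qed
qed (auto simp: forests_def planted_def is_leaf_def)

section \<open>Weights of trees and forests, and their functional equations\<close>

context
  fixes u1 u2 u3 v1 v2 :: "'a::idom"
begin

definition weight :: "ptree \<Rightarrow> 'a" where
  "weight T =
    u1 ^ sleaf T * u2 ^ etleaf T * u3 ^ entleaf T * v1 ^ yerleaf T * v2 ^ syleaf T"

text \<open>The list stands for the children from the third one on, where a leaf is a younger leaf
  and must weigh \<open>v1\<close>; \<open>weight leaf\<close> is 1, as a root is never
  counted.\<close>

definition fweight :: "ptree list \<Rightarrow> 'a" where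
  "fweight ts = (\<Prod>t\<leftarrow>ts. if t = leaf then v1 else weight t)"

lemma fweight_simps [simp]:
  "fweight [] = 1"
  "fweight (t # ts) = (if t = leaf then v1 else weight t) * fweight ts"
  by (simp_all add: fweight_def)

lemma fweight_eq:
  "fweight ts = u1 ^ (\<Sum>t\<leftarrow>ts. sleaf t) * u2 ^ (\<Sum>t\<leftarrow>ts. etleaf t) * u3 ^ (\<Sum>t\<leftarrow>ts. entleaf t) *
     v1 ^ (length (filter is_leaf ts) + (\<Sum>t\<leftarrow>ts. yerleaf t)) * v2 ^ (\<Sum>t\<leftarrow>ts. syleaf t)"
  by (induction ts) (auto simp: weight_def power_add is_leaf_iff)

lemma weight_Node:
  "weight (Node [leaf]) = u1"
  "weight (Node (leaf # leaf # ts)) = u2 * v2 * fweight ts"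
  "t \<noteq> leaf \<Longrightarrow> weight (Node (leaf # t # ts)) = u3 * (weight t * fweight ts)"
  unfolding weight_def fweight_eq
  by (simp_all add: stats_single sleaf_Cons2 etleaf_Cons2 entleaf_Cons2 syleaf_Cons2 yerleaf_Cons2
      is_leaf_iff power_add mult_ac)

definition B :: "'a fps" where "B = gf planted edges weight"

definition L :: "'a fps" where "L = gf forests fsize fweight"

lemma gf_planted_forests:
  "gf (planted \<times> forests) (\<lambda>(t, ts). edges t + fsize ts) (\<lambda>(t, ts). weight t * fweight ts) = B * L"
  unfolding B_def L_def by (rule gf_times[OF finite_planted finite_forests])

lemma L_eq: "L = 1 + fps_X * (fps_const v1 + B) * L"
proof -
  let ?P = "(#) leaf ` forests" and ?Q = "(\<lambda>(t, ts). t # ts) ` (planted \<times> forests)"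
  have sub: "?P \<subseteq> forests" "?Q \<subseteq> forests"
    using forests_decomp by blast+
  have fin: "finite {ts\<in>A. fsize ts = n}" if "A \<subseteq> forests" for A n
    by (rule finite_subset[OF _ finite_forests[of n]]) (use that in auto)
  have "gf ?P fsize fweight = gf forests (\<lambda>ts. 1 + fsize ts) (\<lambda>ts. v1 * fweight ts)"
    by (subst gf_image) (auto simp: inj_on_def intro!: gf_cong)
  also have "\<dots> = fps_const v1 * fps_X * L"
    by (simp only: gf_shift L_def power_one_right)
  finally have P: "gf ?P fsize fweight = fps_const v1 * fps_X * L" .
  \<comment> \<open>The factor 1 and the applied lambdas give the shape that \<open>gf_shift\<close>
    rewrites.\<close>
  have "gf ?Q fsize fweight =
      gf (planted \<times> forests) (\<lambda>p. 1 + (\<lambda>(t, ts). edges t + fsize ts) p)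
        (\<lambda>p. 1 * (\<lambda>(t, ts). weight t * fweight ts) p)"
    by (subst gf_image) (auto simp: inj_on_def planted_def intro!: gf_cong)
  also have "\<dots> = fps_X * (B * L)"
    by (simp only: gf_shift gf_planted_forests) simp
  finally have Q: "gf ?Q fsize fweight = fps_X * (B * L)" .
  have "L = gf ({[]} \<union> (?P \<union> ?Q)) fsize fweight"
    unfolding L_def using forests_decomp by simp
  also have "\<dots> = gf {[]} fsize fweight + gf (?P \<union> ?Q) fsize fweight"
    using sub by (intro gf_Un fin) (auto simp: forests_def)
  also have "gf (?P \<union> ?Q) fsize fweight = gf ?P fsize fweight + gf ?Q fsize fweight"
    using sub by (intro gf_Un fin) (auto simp: planted_def)
  finally show ?thesis
    by (simp add: P Q gf_singleton algebra_simps)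
qed

text \<open>The factor \<open>fps_X ^ 2\<close> accounts for the edges to the first two children. A
  twin pair contributes \<open>u2\<close> and \<open>v2\<close>; before a larger second subtree the
  elder leaf contributes \<open>u3\<close>.\<close>

lemma B_eq: "B = fps_const u1 * fps_X + fps_X ^ 2 * (fps_const (u2 * v2) + fps_const u3 * B) * L"
proof -
  let ?P = "(\<lambda>ts. Node (leaf # leaf # ts)) ` forests"
    and ?Q = "(\<lambda>(t, ts). Node (leaf # t # ts)) ` (planted \<times> forests)"
  have sub: "Node [leaf] \<in> planted" "?P \<subseteq> planted" "?Q \<subseteq> planted"
    using planted_decomp by blast+
  have fin: "finite {T\<in>A. edges T = n}" if "A \<subseteq> planted" for A n
    by (rule finite_subset[OF _ finite_planted[of n]]) (use that in auto)
  have "gf ?P edges weight = gf forests (\<lambda>ts. 2 + fsize ts) (\<lambda>ts. (u2 * v2) * fweight ts)"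
    by (subst gf_image)
      (auto simp: inj_on_def edges_Node weight_Node simp del: edges.simps intro!: gf_cong)
  also have "\<dots> = fps_const (u2 * v2) * fps_X ^ 2 * L"
    by (simp only: gf_shift L_def)
  finally have P: "gf ?P edges weight = fps_const (u2 * v2) * fps_X ^ 2 * L" .
  have "gf ?Q edges weight =
      gf (planted \<times> forests) (\<lambda>p. 2 + (\<lambda>(t, ts). edges t + fsize ts) p)
        (\<lambda>p. u3 * (\<lambda>(t, ts). weight t * fweight ts) p)"
    by (subst gf_image)
      (auto simp: inj_on_def planted_def edges_Node weight_Node simp del: edges.simps intro!: gf_cong)
  also have "\<dots> = fps_const u3 * fps_X ^ 2 * (B * L)"
    by (simp only: gf_shift gf_planted_forests)
  finally have Q: "gf ?Q edges weight = fps_const u3 * fps_X ^ 2 * (B * L)" .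
  have "B = gf ({Node [leaf]} \<union> (?P \<union> ?Q)) edges weight"
    unfolding B_def using planted_decomp by simp
  also have "\<dots> = gf {Node [leaf]} edges weight + gf (?P \<union> ?Q) edges weight"
    using sub by (intro gf_Un fin) auto
  also have "gf (?P \<union> ?Q) edges weight = gf ?P edges weight + gf ?Q edges weight"
    using sub by (intro gf_Un fin) (auto simp: planted_def)
  finally show ?thesis
    by (simp add: P Q gf_singleton weight_Node algebra_simps)
qed

text \<open>By \<open>L_eq\<close>, \<open>L\<close> is inverse to
  \<open>1 - fps_X * (fps_const v1 + B)\<close>; multiplying \<open>B_eq\<close> by this factor
  eliminates \<open>L\<close>.\<close>

lemma B_rational:
  "(B - fps_const u1 * fps_X) * (1 - fps_X * (fps_const v1 + B)) =
     fps_X ^ 2 * (fps_const (u2 * v2) + fps_const u3 * B)"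
proof -
  have "L * (1 - fps_X * (fps_const v1 + B)) = 1"
    using diff_eq_eq[THEN iffD2, OF L_eq] by (simp add: algebra_simps)
  moreover have "B - fps_const u1 * fps_X = fps_X ^ 2 * (fps_const (u2 * v2) + fps_const u3 * B) * L"
    by (rule diff_eq_eq[THEN iffD2, OF trans[OF B_eq add.commute]])
  ultimately show ?thesis
    by (simp only: mult.assoc mult_1_right)
qed

text \<open>The index shift by one matches all coefficients but the first: the tree with one edge
  has weight \<open>u1\<close>, whereas \<open>M 0\<close> is \<open>u3\<close> by convention. The
  constant corrects this.\<close>

lemma B_eq_M:
  "B = fps_X * (Abs_fps (\<lambda>n. M n u1 u2 u3 v1 v2) - fps_const (u3 - u1))"
proof (rule fps_ext)
  fix n
  have nth_B: "fps_nth B (Suc m) = (\<Sum>T\<in>tip_trees (Suc m). weight T)" for m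
    by (auto simp: B_def gf_def tip_trees_def planted_def intro!: sum.cong)
  have "fps_nth B 0 = 0"
    by (subst B_eq) (simp add: power2_eq_square mult.assoc)
  moreover have "fps_nth B 1 = u1"
    by (subst B_eq) (simp add: power2_eq_square mult.assoc)
  ultimately show "fps_nth B n =
      fps_nth (fps_X * (Abs_fps (\<lambda>n. M n u1 u2 u3 v1 v2) - fps_const (u3 - u1))) n"
    by (cases n rule: nat.exhaust; cases "n = 1") (auto simp: nth_B M_def weight_def)
qed

lemma M_quadratic:
  defines "F \<equiv> Abs_fps (\<lambda>n. M n u1 u2 u3 v1 v2)"
  shows "(F - fps_const u3) * (1 - fps_const v1 * fps_X) =
    fps_X ^ 2 * F * (F - fps_const (u3 - u1)) + fps_const (u2 * v2) * fps_X"
proof -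
  have B: "B = fps_X * (F - (fps_const u3 - fps_const u1))"
    using B_eq_M by (simp add: F_def)
  \<comment> \<open>After the substitution \<open>B - fps_const u1 * fps_X\<close> becomes
    \<open>fps_X * (F - fps_const u3)\<close>. The common factor \<open>fps_X\<close> is cancelled
    afterwards, over an integral domain.\<close>
  have "fps_X * ((F - fps_const u3) * (1 - fps_const v1 * fps_X)) =
      fps_X * (fps_X ^ 2 * F * (F - fps_const (u3 - u1)) + fps_const (u2 * v2) * fps_X)"
    using B_rational unfolding B fps_const_sub[symmetric] by algebra
  then show ?thesis by simp
qed

end

theorem theorem1p17:
  fixes u1 u2 u3 v1 v2 :: "'a::field_char_0"
  shows "fps_to_fls (Abs_fps (\<lambda>n. M n u1 u2 u3 v1 v2)) =
    fps_to_fls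
      (1 - fps_const v1 * fps_X + fps_const (u3 - u1) * fps_X ^ 2
       - fps_sqrt1
          (1 - fps_const (2 * v1) * fps_X
             + fps_const (v1 ^ 2 - 2 * (u1 + u3)) * fps_X ^ 2
             + fps_const (2 * (u1 * v1 + u3 * v1 - 2 * u2 * v2)) * fps_X ^ 3
             + fps_const ((u3 - u1) ^ 2) * fps_X ^ 4))
    / (2 * fls_X ^ 2)"
proof -
  define F where "F = Abs_fps (\<lambda>n. M n u1 u2 u3 v1 v2)"
  define D where "D = 1 - fps_const (2 * v1) * fps_X
     + fps_const (v1 ^ 2 - 2 * (u1 + u3)) * fps_X ^ 2
     + fps_const (2 * (u1 * v1 + u3 * v1 - 2 * u2 * v2)) * fps_X ^ 3
     + fps_const ((u3 - u1) ^ 2) * fps_X ^ 4"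
  \<comment> \<open>The candidate for the root, read off from the claimed formula solved for the
    square root.\<close>
  define s where "s = 1 - fps_const v1 * fps_X + fps_const (u3 - u1) * fps_X ^ 2 - 2 * fps_X ^ 2 * F"
  \<comment> \<open>Naming the constant series turns \<open>D\<close> and \<open>s\<close> into
    polynomial expressions that \<open>algebra\<close> can handle.\<close>
  define a1 a2 a3 b1 b2 where coeffs: "a1 = fps_const u1" "a2 = fps_const u2" "a3 = fps_const u3"
    "b1 = fps_const v1" "b2 = fps_const v2"
  have two: "fps_const 2 = (2 :: 'a fps)"
    by (simp add: numeral_fps_const)
  have D: "D = 1 - 2 * b1 * fps_X + (b1 ^ 2 - 2 * (a1 + a3)) * fps_X ^ 2
      + 2 * (a1 * b1 + a3 * b1 - 2 * a2 * b2) * fps_X ^ 3 + (a3 - a1) ^ 2 * fps_X ^ 4"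
    unfolding D_def coeffs two[symmetric]
    by (simp only: fps_const_sub fps_const_add fps_const_mult fps_const_power)
  have s: "s = 1 - b1 * fps_X + (a3 - a1) * fps_X ^ 2 - 2 * fps_X ^ 2 * F"
    by (simp add: s_def coeffs)
  have "(F - a3) * (1 - b1 * fps_X) = fps_X ^ 2 * F * (F - (a3 - a1)) + a2 * b2 * fps_X"
    using M_quadratic[of u1 u2 u3 v1 v2] by (simp add: F_def coeffs)
  \<comment> \<open>Completing the square: \<open>s ^ 2 - D\<close> is \<open>4 * fps_X ^ 2\<close>
    times the difference of the two sides of the quadratic equation, up to sign.\<close>
  then have "s ^ 2 = D"
    unfolding D s by algebra
  moreover have "fps_nth s 0 = 1" "fps_nth D 0 = 1"
    by (simp_all add: s_def D_def power2_eq_square mult.assoc)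
  \<comment> \<open>The constant term 1 selects \<open>s\<close> over \<open>- s\<close>.\<close>
  ultimately have "fps_sqrt1 D = s"
    using fps_sqrt1_unique[of D s] by simp
  then have "1 - fps_const v1 * fps_X + fps_const (u3 - u1) * fps_X ^ 2 - fps_sqrt1 D =
      2 * fps_X ^ 2 * F"
    by (simp add: s_def)
  moreover have "fps_to_fls (2 * fps_X ^ 2 * F) = (2 * fls_X ^ 2) * fps_to_fls F"
    by (simp add: fls_times_fps_to_fls fps_to_fls_power)
  moreover have "(2 * fls_X ^ 2 :: 'a fls) \<noteq> 0"
    by simp
  ultimately show ?thesis
    unfolding D_def F_def by simp
qed

end
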